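(* Let $A\in\mathbb{R}^{d\times d}$ and $f:\mathbb{R}^d\to\mathbb{R}^d$ be such that the differential-algebraic equation (DAE) $A\dot z=f(z)$ is regular with configuration space $\mathcal{M}=\{z\in\mathbb{R}^d \mid g_i(z)=0\ (i=1,\dots,k)\}$. Let $\tilde V:\mathbb{R}^d\to\mathbb{R}$ be a $C^{r+1}$ function with $r\ge 1$, and suppose that $g_i:\mathbb{R}^d\to\mathbb{R}$ is a $C^{r+1}$ function for each $i=1,\dots,k$. Then there exists a $C^r$ function $V:\mathbb{R}^d\to\mathbb{R}$ that is proper for the DAE and satisfies $V(z)=\tilde V(z)$ for every $z\in\mathcal{M}$.
   Context: The DAE $A\dot z=f(z)$, with $A\in\mathbb{R}^{d\times d}$ possibly singular, is called regular if there are a differentiable submanifold $\mathcal{M}$ of $\mathbb{R}^d$ (the configuration space) and a vector field $v:\mathcal{M}\to T\mathcal{M}$ such that a differentiable map $w:[0,T)\to\mathcal{M}$ is a solution of $\dot w=v(w)$ if and only if $z=j\circ w$ is a solution of the DAE, where $j:\mathcal{M}\to\mathbb{R}^d$ is the inclusion. $\mathcal{M}$ is the maximal manifold such that for every $z\in\mathcal{M}$ the set $T_z\mathcal{M}\cap\{w\in\mathbb{R}^d\mid Aw=f(z)\}$ is a singleton. The functions $g_i$ describe $\mathcal{M}$ as a submanifold: $\mathcal{M}=\{z\mid g_i(z)=0,\ i=1,\dots,k\}$ and $T_z\mathcal{M}=\{w\in\mathbb{R}^d\mid\langle\nabla g_i(z),w\rangle=0\ (i=1,\dots,k)\}$ for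 $z\in\mathcal{M}$. Let $\mathrm{null}(A)$ be the null space of $A$ and $\mathrm{car}(A)=\mathrm{null}(A)^\perp$. A differentiable function $V:\mathbb{R}^d\to\mathbb{R}$ is called proper for the DAE if $\nabla V(z)\in\mathrm{car}(A)$ for every $z\in\mathcal{M}$. *)

theory Defs
  imports "HOL-Analysis.Analysis"
begin

(* Meant for open S. On a finite-dimensional domain, continuity of all iterated directional
   derivatives is the usual continuity of all partial derivatives of order at most n. *)
primrec Ck_on :: "nat \<Rightarrow> 'a::euclidean_space set \<Rightarrow> ('a \<Rightarrow> 'b::real_normed_vector) \<Rightarrow> bool" where
  "Ck_on 0 S f \<longleftrightarrow> continuous_on S f"
| "Ck_on (Suc n) S f \<longleftrightarrow>
     (\<exists>f'. (\<forall>x\<in>S. (f has_derivative f' x) (at x)) \<and> (\<forall>h. Ck_on n S (\<lambda>x. f' x h)))"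

definition gradient :: "('a::euclidean_space \<Rightarrow> real) \<Rightarrow> 'a \<Rightarrow> 'a" where
  "gradient f z = (THE D. GDERIV f z :> D)"

(* Embedded submanifolds, without boundary and of one dimension m, given by local C^1
   diffeomorphisms of the ambient space that straighten M to a linear subspace. *)
definition submanifold :: "'a::euclidean_space set \<Rightarrow> bool" where
  "submanifold M \<longleftrightarrow>
     (\<exists>m. \<forall>p\<in>M. \<exists>U W \<phi> \<psi> E. open U \<and> p \<in> U \<and> open (W :: 'a set) \<and>
        homeomorphism U W \<phi> \<psi> \<and> Ck_on 1 U \<phi> \<and> Ck_on 1 W \<psi> \<and>
        subspace (E :: 'a set) \<and> dim E = m \<and> \<phi> ` (U \<inter> M) = W \<inter> E)"

definition tangent_space :: "'a::euclidean_space set \<Rightarrow> 'a \<Rightarrow> 'a set" where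
  "tangent_space M z =
     {w. \<exists>\<epsilon>>0. \<exists>c. c C1_differentiable_on {-\<epsilon><..<\<epsilon>} \<and> c ` {-\<epsilon><..<\<epsilon>} \<subseteq> M \<and>
           c 0 = z \<and> (c has_vector_derivative w) (at 0)}"

definition ode_solution :: "('a::euclidean_space \<Rightarrow> 'a) \<Rightarrow> real \<Rightarrow> (real \<Rightarrow> 'a) \<Rightarrow> bool" where
  "ode_solution v T w \<longleftrightarrow>
     (\<forall>t\<in>{0..<T}. (w has_vector_derivative v (w t)) (at t within {0..<T}))"

definition dae_solution ::
    "real^'d^'d \<Rightarrow> (real^'d \<Rightarrow> real^'d) \<Rightarrow> real \<Rightarrow> (real \<Rightarrow> real^'d) \<Rightarrow> bool" where
  "dae_solution A f T z \<longleftrightarrow>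
     (\<forall>t\<in>{0..<T}. \<exists>z'. (z has_vector_derivative z') (at t within {0..<T}) \<and> A *v z' = f (z t))"

definition dae_vector_field ::
    "real^'d^'d \<Rightarrow> (real^'d \<Rightarrow> real^'d) \<Rightarrow> (real^'d) set \<Rightarrow> (real^'d \<Rightarrow> real^'d) \<Rightarrow> bool" where
  "dae_vector_field A f M v \<longleftrightarrow>
     (\<forall>z\<in>M. v z \<in> tangent_space M z) \<and>
     (\<forall>T>0. \<forall>w. w ` {0..<T} \<subseteq> M \<and> w differentiable_on {0..<T} \<longrightarrow>
        (ode_solution v T w \<longleftrightarrow> dae_solution A f T w))"

definition unique_tangent_velocity ::
    "real^'d^'d \<Rightarrow> (real^'d \<Rightarrow> real^'d) \<Rightarrow> (real^'d) set \<Rightarrow> bool" where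
  "unique_tangent_velocity A f M \<longleftrightarrow>
     (\<forall>z\<in>M. is_singleton (tangent_space M z \<inter> {w. A *v w = f z}))"

(* The last conjunct makes M maximal with respect to inclusion. *)
definition regular_dae ::
    "real^'d^'d \<Rightarrow> (real^'d \<Rightarrow> real^'d) \<Rightarrow> (real^'d) set \<Rightarrow> bool" where
  "regular_dae A f M \<longleftrightarrow>
     submanifold M \<and> (\<exists>v. dae_vector_field A f M v) \<and> unique_tangent_velocity A f M \<and>
     (\<forall>N. submanifold N \<and> unique_tangent_velocity A f N \<and> M \<subseteq> N \<longrightarrow> N = M)"

definition null :: "real^'d^'d \<Rightarrow> (real^'d) set" where
  "null A = {x. A *v x = 0}"

definition car :: "real^'d^'d \<Rightarrow> (real^'d) set" where
  "car A = orthogonal_comp (null A)"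

definition proper_for_dae ::
    "real^'d^'d \<Rightarrow> (real^'d) set \<Rightarrow> (real^'d \<Rightarrow> real) \<Rightarrow> bool" where
  "proper_for_dae A M V \<longleftrightarrow>
     (\<forall>z. V differentiable (at z)) \<and> (\<forall>z\<in>M. gradient V z \<in> car A)"

end

(* On M the correction term of V = V' + (SUM i. lam i * g i) has gradient
   (SUM i. lam i * grad (g i)), so it suffices to find C^r multipliers lam i such that
   grad V' + (SUM i. lam i * grad (g i)) lies in the range of A^T, which is contained in car A.
   Consider the symmetric matrix
     S z = (SUM i. grad (g i) z (grad (g i) z)^T) + A^T A + (SUM i. (g i z)^2) I.
   It is positive definite everywhere: off M because of the last summand, and on M because
   regularity gives that null A meets the tangent space trivially.  So S y = - grad V' has a global
   C^r solution y by Cramer's rule, and lam i = <grad (g i), y> gives grad V = - A^T A y on M.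
   The last summand of S makes any cut-off around M superfluous. *)
theory Submission
  imports Defs
begin

section \<open>Algebra of functions of class \<open>C\<^sup>n\<close>\<close>

lemma Ck_on_cong:
  assumes "open S" and "\<And>x. x \<in> S \<Longrightarrow> f x = g x" and "Ck_on n S f"
  shows "Ck_on n S g"
proof (cases n)
  case 0
  with assms show ?thesis using continuous_on_cong by fastforce
next
  case (Suc m)
  with assms(3) obtain f' where f': "\<And>x. x \<in> S \<Longrightarrow> (f has_derivative f' x) (at x)"
    and *: "\<And>h. Ck_on m S (\<lambda>x. f' x h)" by auto
  have "(g has_derivative f' x) (at x)" if "x \<in> S" for x
    using has_derivative_transform_within_open[OF f'[OF that] assms(1) that] assms(2) by blast
  with * Suc show ?thesis by auto
qed

lemma Ck_on_Suc_imp: "Ck_on (Suc n) S f \<Longrightarrow> Ck_on n S f"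
proof (induction n arbitrary: f)
  case 0
  then obtain f' where "\<forall>x\<in>S. (f has_derivative f' x) (at x)" by auto
  then show ?case
    by (auto intro!: continuous_at_imp_continuous_on dest: has_derivative_continuous)
next
  case (Suc n)
  from Suc.prems obtain f' where "\<forall>x\<in>S. (f has_derivative f' x) (at x)"
    and "\<forall>h. Ck_on (Suc n) S (\<lambda>x. f' x h)" by (subst (asm) Ck_on.simps(2)) blast
  with Suc.IH show ?case by (subst Ck_on.simps(2)) blast
qed

lemma Ck_on_const: "Ck_on n S (\<lambda>x. c)"
proof (induction n arbitrary: c)
  case (Suc n)
  show ?case unfolding Ck_on.simps
    by (rule exI[of _ "\<lambda>x h. 0"]) (use Suc in auto)
qed simp

lemma Ck_on_add: "Ck_on n S f \<Longrightarrow> Ck_on n S g \<Longrightarrow> Ck_on n S (\<lambda>x. f x + g x)"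
proof (induction n arbitrary: f g)
  case (Suc n)
  then obtain f' g' where "\<forall>x\<in>S. (f has_derivative f' x) (at x)" "\<forall>h. Ck_on n S (\<lambda>x. f' x h)"
    "\<forall>x\<in>S. (g has_derivative g' x) (at x)" "\<forall>h. Ck_on n S (\<lambda>x. g' x h)" by auto
  then show ?case unfolding Ck_on.simps
    by (intro exI[of _ "\<lambda>x h. f' x h + g' x h"]) (auto intro: has_derivative_add Suc.IH)
qed (auto intro: continuous_on_add)

lemma Ck_on_mult:
  fixes f g :: "'a::euclidean_space \<Rightarrow> 'b::real_normed_algebra"
  shows "Ck_on n S f \<Longrightarrow> Ck_on n S g \<Longrightarrow> Ck_on n S (\<lambda>x. f x * g x)"
proof (induction n arbitrary: f g)
  case (Suc n)
  then obtain f' g' where "\<forall>x\<in>S. (f has_derivative f' x) (at x)" "\<forall>h. Ck_on n S (\<lambda>x. f' x h)"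
    "\<forall>x\<in>S. (g has_derivative g' x) (at x)" "\<forall>h. Ck_on n S (\<lambda>x. g' x h)" by auto
  \<comment> \<open>The product rule leaves one factor underived in each term, so the induction
    hypothesis is also applied to \<open>f\<close> and \<open>g\<close> themselves.\<close>
  moreover have "Ck_on n S f" "Ck_on n S g" using Suc.prems Ck_on_Suc_imp by blast+
  ultimately show ?case unfolding Ck_on.simps(2)
    by (intro exI[of _ "\<lambda>x h. f x * g' x h + f' x h * g x"])
      (auto intro!: has_derivative_mult Ck_on_add Suc.IH)
qed (auto intro: continuous_on_mult)

text \<open>The derivative of \<open>inverse (f x)\<close> contains \<open>inverse (f x)\<close>
  again, one class lower, so the induction feeds on its own claim for the same
  \<open>f\<close>.\<close>

lemma Ck_on_inverse:
  fixes f :: "'a::euclidean_space \<Rightarrow> 'b::real_normed_field"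
  assumes "\<And>x. x \<in> S \<Longrightarrow> f x \<noteq> 0" and "Ck_on n S f"
  shows "Ck_on n S (\<lambda>x. inverse (f x))"
  using assms(2)
proof (induction n)
  case 0
  then show ?case using assms(1) by (auto intro: continuous_on_inverse)
next
  case (Suc n)
  then obtain f' where f': "\<forall>x\<in>S. (f has_derivative f' x) (at x)" "\<forall>h. Ck_on n S (\<lambda>x. f' x h)"
    by auto
  have inv: "Ck_on n S (\<lambda>x. inverse (f x))"
    using Suc Ck_on_Suc_imp by blast
  have "Ck_on n S (\<lambda>x. (-1) * (inverse (f x) * f' x h * inverse (f x)))" for h
    using f' inv by (intro Ck_on_mult Ck_on_const) auto
  then show ?case unfolding Ck_on.simps(2) using f' assms(1)
    by (intro exI[of _ "\<lambda>x h. - (inverse (f x) * f' x h * inverse (f x))"])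
      (auto intro!: has_derivative_inverse)
qed

lemma Ck_on_sum: "(\<And>i. i \<in> I \<Longrightarrow> Ck_on n S (f i)) \<Longrightarrow> Ck_on n S (\<lambda>x. \<Sum>i\<in>I. f i x)"
  by (induction I rule: infinite_finite_induct) (auto intro: Ck_on_const Ck_on_add)

lemma Ck_on_prod:
  fixes f :: "'i \<Rightarrow> 'a::euclidean_space \<Rightarrow> 'b::real_normed_field"
  shows "(\<And>i. i \<in> I \<Longrightarrow> Ck_on n S (f i)) \<Longrightarrow> Ck_on n S (\<lambda>x. \<Prod>i\<in>I. f i x)"
  by (induction I rule: infinite_finite_induct) (auto intro: Ck_on_const Ck_on_mult)

lemma Ck_on_det:
  fixes B :: "'a::euclidean_space \<Rightarrow> real^'n^'n"
  assumes "\<And>i j. Ck_on n S (\<lambda>x. B x $ i $ j)"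
  shows "Ck_on n S (\<lambda>x. det (B x))"
  unfolding det_def by (intro Ck_on_sum Ck_on_mult Ck_on_const Ck_on_prod assms)

text \<open>Cramer's rule writes each component of \<open>y\<close> as a quotient of determinants of
  class C^n. Nothing is assumed about how \<open>y\<close> depends on \<open>x\<close>, so a
  pointwise choice of solutions will do.\<close>

lemma Ck_on_linear_solve:
  fixes B :: "'a::euclidean_space \<Rightarrow> real^'n^'n" and b y :: "'a \<Rightarrow> real^'n"
  assumes "\<And>x. x \<in> S \<Longrightarrow> det (B x) \<noteq> 0" and "\<And>x. x \<in> S \<Longrightarrow> B x *v y x = b x" and "open S"
    and B: "\<And>i j. Ck_on n S (\<lambda>x. B x $ i $ j)" and b: "\<And>i. Ck_on n S (\<lambda>x. b x $ i)"
  shows "Ck_on n S (\<lambda>x. y x $ k)"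
proof -
  let ?C = "\<lambda>x. (\<chi> i j. if j = k then b x $ i else B x $ i $ j) :: real^'n^'n"
  have "Ck_on n S (\<lambda>x. ?C x $ i $ j)" for i j
    using B b by (cases "j = k") auto
  then have "Ck_on n S (\<lambda>x. det (?C x) * inverse (det (B x)))"
    by (intro Ck_on_mult Ck_on_inverse Ck_on_det B assms(1))
  moreover have "det (?C x) * inverse (det (B x)) = y x $ k" if "x \<in> S" for x
    using cramer[OF assms(1)[OF that], of "y x" "b x"] assms(2)[OF that]
    by (metis (no_types, lifting) divide_inverse vec_lambda_beta)
  ultimately show ?thesis by (rule Ck_on_cong[OF assms(3), rotated])
qed

section \<open>Gradients\<close>

lemma GDERIV_gradient: "GDERIV f z :> D \<Longrightarrow> gradient f z = D"
  unfolding gradient_def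
proof (rule the_equality)
  fix E assume "GDERIV f z :> D" "GDERIV f z :> E"
  then have "h \<bullet> D = h \<bullet> E" for h
    unfolding gderiv_def by (metis has_derivative_unique)
  then show "E = D" by (metis vector_eq_ldot)
qed

text \<open>Riesz representation of the functional \<open>f'\<close> in the standard orthonormal
  basis.\<close>

lemma GDERIV_of_has_derivative:
  fixes f :: "'a::euclidean_space \<Rightarrow> real"
  assumes "(f has_derivative f') (at z)"
  shows "GDERIV f z :> (\<Sum>b\<in>Basis. f' b *\<^sub>R b)"
proof -
  interpret linear f' using assms by (rule has_derivative_linear)
  have "f' h = h \<bullet> (\<Sum>b\<in>Basis. f' b *\<^sub>R b)" for h
  proof -
    have "f' h = f' (\<Sum>b\<in>Basis. (h \<bullet> b) *\<^sub>R b)" by (simp add: euclidean_representation)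
    then show ?thesis by (simp add: sum scale inner_sum_right mult.commute)
  qed
  then have "f' = (\<lambda>h. h \<bullet> (\<Sum>b\<in>Basis. f' b *\<^sub>R b))" by blast
  with assms show ?thesis unfolding gderiv_def by metis
qed

lemma Ck_on_gradient:
  assumes "Ck_on (Suc n) S f" and "open S"
  shows "z \<in> S \<Longrightarrow> GDERIV f z :> gradient f z"
    and "Ck_on n S (\<lambda>z. gradient f z \<bullet> h)"
proof -
  obtain f' where f': "\<And>x. x \<in> S \<Longrightarrow> (f has_derivative f' x) (at x)"
    and *: "\<And>h. Ck_on n S (\<lambda>x. f' x h)" using assms by auto
  have G: "GDERIV f z :> gradient f z" if "z \<in> S" for z
    using GDERIV_of_has_derivative[OF f'[OF that]] GDERIV_gradient by metis
  then show "z \<in> S \<Longrightarrow> GDERIV f z :> gradient f z" .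
  have "f' z h = gradient f z \<bullet> h" if "z \<in> S" for z
    using has_derivative_unique[OF f'[OF that] G[OF that, unfolded gderiv_def]]
    by (metis inner_commute)
  then show "Ck_on n S (\<lambda>z. gradient f z \<bullet> h)"
    by (rule Ck_on_cong[OF assms(2) _ *])
qed

lemma GDERIV_sum:
  assumes "\<And>i. i \<in> I \<Longrightarrow> GDERIV (f i) x :> D i"
  shows "GDERIV (\<lambda>x. \<Sum>i\<in>I. f i x) x :> (\<Sum>i\<in>I. D i)"
  using assms by (induction I rule: infinite_finite_induct) (auto intro: GDERIV_const GDERIV_add)

section \<open>Construction of the proper function\<close>

text \<open>By adjointness, pairing with \<open>w\<close> gives \<open>x \<bullet> (A *v w)\<close>,
  which is 0 on \<open>null A\<close>.\<close>

lemma transpose_mult_in_car: "transpose A *v x \<in> car A"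
proof -
  have "(transpose A *v x) \<bullet> w = x \<bullet> (A *v w)" for w
    by (simp add: dot_lmul_matrix)
  then show ?thesis
    unfolding car_def null_def orthogonal_comp_def orthogonal_def
    by (auto simp: inner_commute)
qed

text \<open>If \<open>w\<close> is the unique tangent velocity, then \<open>w + x\<close> is another
  one. Linearity of the tangent space is a hypothesis because \<open>tangent_space\<close> is
  defined through curves; the description by gradients supplies it later.\<close>

lemma unique_tangent_velocity_null:
  assumes "unique_tangent_velocity A f M" and "z \<in> M" and "subspace (tangent_space M z)"
    and "x \<in> tangent_space M z" and "A *v x = 0"
  shows "x = 0"
proof -
  obtain w where w: "tangent_space M z \<inter> {w. A *v w = f z} = {w}"
    using assms(1,2) unfolding unique_tangent_velocity_def is_singleton_def by blast
  then have "w \<in> tangent_space M z" "A *v w = f z" by blast+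
  then have "w + x \<in> tangent_space M z \<inter> {w. A *v w = f z}"
    using assms(3-5) by (simp add: subspace_add matrix_vector_right_distrib)
  with w have "w + x = w" by blast
  then show ?thesis by simp
qed

theorem proposition4p2:
  fixes A :: "real^'d^'d" and f :: "real^'d \<Rightarrow> real^'d" and M :: "(real^'d) set"
    and k r :: nat and g :: "nat \<Rightarrow> real^'d \<Rightarrow> real" and V' :: "real^'d \<Rightarrow> real"
  assumes "regular_dae A f M"
    and "M = {z. \<forall>i\<in>{1..k}. g i z = 0}"
    and "\<And>z. z \<in> M \<Longrightarrow> tangent_space M z = {w. \<forall>i\<in>{1..k}. gradient (g i) z \<bullet> w = 0}"
    and "r \<ge> 1"
    and "Ck_on (r + 1) UNIV V'"
    and "\<And>i. i \<in> {1..k} \<Longrightarrow> Ck_on (r + 1) UNIV (g i)"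
  shows "\<exists>V :: real^'d \<Rightarrow> real. Ck_on r UNIV V \<and> proper_for_dae A M V \<and> (\<forall>z\<in>M. V z = V' z)"
proof -
  define I where "I = {1..k}"
  have finI: "finite I" by (simp add: I_def)
  have M: "M = {z. \<forall>i\<in>I. g i z = 0}" using assms(2) by (simp add: I_def)
  have g_Suc: "Ck_on (Suc r) UNIV (g i)" if "i \<in> I" for i
    using assms(6) that by (simp add: I_def)
  have V'_Suc: "Ck_on (Suc r) UNIV V'" using assms(5) by simp
  have utv: "unique_tangent_velocity A f M" using assms(1) by (simp add: regular_dae_def)
  have comp: "gradient u z $ a = gradient u z \<bullet> axis a 1" for u :: "real^'d \<Rightarrow> real" and z a
    by (simp add: inner_axis)

  define L where "L z x = (\<Sum>i\<in>I. (gradient (g i) z \<bullet> x) *\<^sub>R gradient (g i) z)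
    + transpose A *v (A *v x) + (\<Sum>i\<in>I. g i z * g i z) *\<^sub>R x" for z x :: "real^'d"
  have lin: "linear (L z)" for z
    unfolding L_def
    by (rule linearI)
      (simp_all add: algebra_simps sum.distrib scaleR_sum_right)
  \<comment> \<open>The quadratic form is a sum of nonnegative terms, so each of them vanishes on
    the kernel of \<open>L z\<close>.\<close>
  have Lx: "L z x \<bullet> x = (\<Sum>i\<in>I. (gradient (g i) z \<bullet> x)\<^sup>2) + (A *v x) \<bullet> (A *v x)
    + (\<Sum>i\<in>I. (g i z)\<^sup>2) * (x \<bullet> x)" for z x
    by (simp add: L_def inner_add_left inner_sum_left power2_eq_square dot_lmul_matrix)
  have inj: "x = 0" if 0: "L z x = 0" for z x
  proof -
    have "(\<Sum>i\<in>I. (gradient (g i) z \<bullet> x)\<^sup>2) + (A *v x) \<bullet> (A *v x)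
      + (\<Sum>i\<in>I. (g i z)\<^sup>2) * (x \<bullet> x) = 0"
      using Lx[of z x] 0 by simp
    moreover have "0 \<le> (\<Sum>i\<in>I. (gradient (g i) z \<bullet> x)\<^sup>2)" "0 \<le> (A *v x) \<bullet> (A *v x)"
      "0 \<le> (\<Sum>i\<in>I. (g i z)\<^sup>2) * (x \<bullet> x)"
      by (auto intro!: sum_nonneg mult_nonneg_nonneg)
    ultimately have *: "(\<Sum>i\<in>I. (gradient (g i) z \<bullet> x)\<^sup>2) = 0" "(A *v x) \<bullet> (A *v x) = 0"
      "(\<Sum>i\<in>I. (g i z)\<^sup>2) * (x \<bullet> x) = 0" by linarith+
    show "x = 0"
    proof (cases "z \<in> M")
      case False
      then have "(\<Sum>i\<in>I. (g i z)\<^sup>2) \<noteq> 0"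
        unfolding M by (simp add: sum_nonneg_eq_0_iff[OF finI])
      with *(3) show ?thesis by simp
    next
      case True
      have T: "tangent_space M z = {w. \<forall>i\<in>I. gradient (g i) z \<bullet> w = 0}"
        using assms(3)[OF True] by (simp add: I_def)
      show ?thesis
      proof (rule unique_tangent_velocity_null[OF utv True])
        show "subspace (tangent_space M z)"
          unfolding T subspace_def by (auto simp: inner_add_right)
        show "x \<in> tangent_space M z"
          \<comment> \<open>A vanishing sum of squares makes \<open>x\<close> orthogonal to every
            gradient.\<close>
          using *(1) unfolding T by (simp add: sum_nonneg_eq_0_iff[OF finI])
        show "A *v x = 0" using *(2) by simp
      qed
    qed
  qed
  define S where "S z = matrix (L z)" for z
  have S: "S z *v x = L z x" for z x
    unfolding S_def using matrix_vector_mul(2)[OF lin] by metis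
  have det: "det (S z) \<noteq> 0" for z
  proof -
    have "inj ((*v) (S z))"
      using inj linear_injective_0[OF lin, of z] S by (metis ext)
    then show ?thesis
      by (metis invertible_det_nz invertible_left_inverse matrix_left_invertible_injective)
  qed
  have "\<forall>z. \<exists>x. S z *v x = - gradient V' z"
    using cramer[OF det] by blast
  \<comment> \<open>Here \<open>y\<close> is only chosen point by point; its smoothness is
    established in \<open>Cky\<close>.\<close>
  then obtain y where Sy: "\<And>z. S z *v y z = - gradient V' z" by metis
  have Ckg: "Ck_on r UNIV (\<lambda>z. gradient (g i) z $ a)" if "i \<in> I" for i a
    unfolding comp using Ck_on_gradient(2)[OF g_Suc[OF that]] by simp
  have CkS: "Ck_on r UNIV (\<lambda>z. S z $ a $ b)" for a b
  proof -
    \<comment> \<open>Column \<open>b\<close> is \<open>L z\<close> applied to a unit vector. The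
      entry coming from \<open>transpose A\<close> and \<open>A\<close> is constant in
      \<open>z\<close>; the others are polynomials in C^r functions.\<close>
    have "S z $ a $ b = (\<Sum>i\<in>I. gradient (g i) z $ b * gradient (g i) z $ a)
      + (transpose A *v (A *v axis b 1)) $ a + (\<Sum>i\<in>I. g i z * g i z) * axis b 1 $ a" for z
      by (simp add: S_def matrix_def L_def inner_axis)
    then show ?thesis
      by (simp only:)
        (intro Ck_on_add Ck_on_sum Ck_on_mult Ck_on_const Ckg Ck_on_Suc_imp[OF g_Suc]; assumption)
  qed
  have "Ck_on r UNIV (\<lambda>z. (- 1) * (gradient V' z \<bullet> axis a 1))" for a
    by (intro Ck_on_mult Ck_on_const Ck_on_gradient(2)[OF V'_Suc]) simp
  then have "Ck_on r UNIV (\<lambda>z. (- gradient V' z) $ a)" for a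
    by (simp add: comp)
  then have Cky: "Ck_on r UNIV (\<lambda>z. y z $ a)" for a
    using Ck_on_linear_solve[of UNIV S y] det Sy CkS by simp

  \<comment> \<open>The gradients cost one derivative, so the multipliers, and with them
    \<open>V\<close>, are obtained in class C^r only.\<close>
  define lam where "lam i z = gradient (g i) z \<bullet> y z" for i z
  have Cklam: "Ck_on r UNIV (lam i)" if "i \<in> I" for i
    unfolding lam_def inner_vec_def inner_real_def
    by (intro Ck_on_sum Ck_on_mult Ckg that Cky)
  define V where "V z = V' z + (\<Sum>i\<in>I. lam i z * g i z)" for z
  have CkV: "Ck_on r UNIV V"
    unfolding V_def
    by (intro Ck_on_add Ck_on_sum Ck_on_mult Cklam Ck_on_Suc_imp[OF V'_Suc] Ck_on_Suc_imp[OF g_Suc])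
  \<comment> \<open>Since \<open>r\<close> is positive, \<open>V\<close> and the multipliers are
    differentiable.\<close>
  obtain m where m: "r = Suc m" using assms(4) by (cases r) auto
  have diff: "V differentiable (at z)" for z
    using CkV unfolding m differentiable_def by auto
  have "gradient V z \<in> car A" if z: "z \<in> M" for z
  proof -
    have g0: "g i z = 0" if "i \<in> I" for i using z that by (simp add: M)
    \<comment> \<open>The other term of the product rule, with the gradient of \<open>lam i\<close>,
      carries the factor \<open>g i z\<close>, which is 0 on \<open>M\<close>.\<close>
    have "GDERIV (\<lambda>z. lam i z * g i z) z :> lam i z *\<^sub>R gradient (g i) z" if "i \<in> I" for i
    proof -
      have "GDERIV (lam i) z :> gradient (lam i) z"
        using Ck_on_gradient(1)[OF Cklam[OF that, unfolded m]] by simp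
      from GDERIV_mult[OF this Ck_on_gradient(1)[OF g_Suc[OF that]]] g0[OF that]
      show ?thesis by simp
    qed
    then have "GDERIV V z :> gradient V' z + (\<Sum>i\<in>I. lam i z *\<^sub>R gradient (g i) z)"
      unfolding V_def by (intro GDERIV_add GDERIV_sum Ck_on_gradient(1)[OF V'_Suc]) auto
    \<comment> \<open>At points of \<open>M\<close> the last summand of \<open>L\<close> drops out,
      and the coefficients of the gradients in \<open>L z (y z)\<close> are exactly
      \<open>lam i z\<close>.\<close>
    moreover have "(\<Sum>i\<in>I. lam i z *\<^sub>R gradient (g i) z) + transpose A *v (A *v y z)
        = - gradient V' z"
      using Sy[of z] g0 by (simp add: S L_def lam_def)
    then have "gradient V' z + (\<Sum>i\<in>I. lam i z *\<^sub>R gradient (g i) z)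
        = - (transpose A *v (A *v y z))"
      by (simp only: eq_neg_iff_add_eq_0 ac_simps)
    \<comment> \<open>The sign moves into the argument, which exhibits a vector in the range of
      \<open>transpose A\<close>.\<close>
    ultimately have "gradient V z = transpose A *v (A *v (- y z))"
      by (simp only: GDERIV_gradient linear_neg[OF matrix_vector_mul_linear])
    then show ?thesis by (metis transpose_mult_in_car)
  qed
  moreover have "V z = V' z" if "z \<in> M" for z
    using that by (simp add: V_def M)
  ultimately show ?thesis using CkV diff unfolding proper_for_dae_def by blast
qed

end
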